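(* Let $\theta=(k_r)_{r\ge 0}$ be a lacunary sequence and let $q_r=k_r/k_{r-1}$. If $\limsup_{r\to\infty} q_r<\infty$, then $ASC_\theta\subseteq ASC$.
   Context: Sequences $x=(x_m)$ are real sequences indexed by the positive integers. For positive integers $m,n$, $\langle m,n\rangle$ denotes the greatest common divisor of $m$ and $n$. The number of elements of a finite set $A$ is denoted $|A|$. A lacunary sequence is a strictly increasing sequence $\theta=(k_r)_{r\ge 0}$ of nonnegative integers such that $h_r:=k_r-k_{r-1}\to\infty$ as $r\to\infty$. For $r\ge1$ put $I_r=(k_{r-1},k_r]$ (viewed as a set of integers), and $q_r=k_r/k_{r-1}$ (for those $r\ge 1$ with $k_{r-1}\neq 0$). $ASC$ is the set of all arithmetic statistically convergent sequences: $x\in ASC$ iff for each $\varepsilon>0$ there is a positive integer $n$ such that $$\lim_{t\to\infty}\frac1t\left|\{m\le t: |x_m-x_{\langle m,n\rangle}|\ge\varepsilon\}\right|=0.$$ $ASC_\theta$ is the set of all lacunary arithmetic statistically convergent sequences: $x\in ASC_\theta$ iff for each $\varepsilon>0$ there is a positive integer $n$ such that $$\lim_{r\to\infty}\frac1{h_r}\left|\{m\in I_r: |x_m-x_{\langle m,n\rangle}|\ge\varepsilon\}\right|=0.$$ *)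

theory Defs
  imports "HOL-Analysis.Analysis"
begin

text \<open>
  A real sequence indexed by the positive integers is a function on \<open>nat\<close> whose value at
  \<open>0\<close> is never inspected: below, \<open>m \<ge> 1\<close> and \<open>n \<ge> 1\<close>, hence also \<open>gcd m n \<ge> 1\<close>.

  A lacunary sequence is given by \<open>k :: nat \<Rightarrow> nat\<close>. The step lengths, blocks and
  ratios are meant for \<open>r \<ge> 1\<close>; their values at \<open>r = 0\<close>, and the value \<open>0\<close> that
  \<open>lac_ratio\<close> takes at \<open>r = 1\<close> if \<open>k 0 = 0\<close>, are irrelevant since only limits as
  \<open>r\<close> tends to infinity are taken.
\<close>

definition lac_step :: "(nat \<Rightarrow> nat) \<Rightarrow> nat \<Rightarrow> nat" where
  "lac_step k r = k r - k (r - 1)"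

definition lac_block :: "(nat \<Rightarrow> nat) \<Rightarrow> nat \<Rightarrow> nat set" where
  "lac_block k r = {k (r - 1)<..k r}"

definition lac_ratio :: "(nat \<Rightarrow> nat) \<Rightarrow> nat \<Rightarrow> real" where
  "lac_ratio k r = real (k r) / real (k (r - 1))"

definition lacunary :: "(nat \<Rightarrow> nat) \<Rightarrow> bool" where
  "lacunary k \<longleftrightarrow> strict_mono k \<and> filterlim (lac_step k) at_top sequentially"

definition ASC :: "(nat \<Rightarrow> real) set" where
  "ASC = {x. \<forall>\<epsilon>>0. \<exists>n>0.
     (\<lambda>t. real (card {m \<in> {1..t}. \<bar>x m - x (gcd m n)\<bar> \<ge> \<epsilon>}) / real t)
       \<longlonglongrightarrow> 0}"

definition ASC_lac :: "(nat \<Rightarrow> nat) \<Rightarrow> (nat \<Rightarrow> real) set" where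
  "ASC_lac k = {x. \<forall>\<epsilon>>0. \<exists>n>0.
     (\<lambda>r. real (card {m \<in> lac_block k r. \<bar>x m - x (gcd m n)\<bar> \<ge> \<epsilon>}) / real (lac_step k r))
       \<longlonglongrightarrow> 0}"

end

theory Submission
  imports Defs
begin

text \<open>
  If from some index \<open>R\<close> on every block contains at most \<open>e h\<^sub>r\<close> exceptional integers, summing over
  blocks leaves at most \<open>k\<^sub>R + e k\<^sub>r\<close> of them up to \<open>k\<^sub>r\<close>. For \<open>k\<^sub>r\<^sub>-\<^sub>1 < t \<le> k\<^sub>r\<close>, a bound \<open>M\<close>
  on the ratios gives \<open>k\<^sub>r \<le> M t\<close>, so the density up to \<open>t\<close> is at most \<open>k\<^sub>R / t + e M\<close>.
\<close>

lemma card_initial_le_lac_blocks: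
  fixes k :: "nat \<Rightarrow> nat"
  assumes "strict_mono k"
    and block: "\<And>r. r > R \<Longrightarrow> real (card {m \<in> lac_block k r. P m}) \<le> e * real (lac_step k r)"
    and "R \<le> r"
  shows "real (card {m \<in> {1..k r}. P m}) \<le> real (k R) + e * (real (k r) - real (k R))"
  using \<open>R \<le> r\<close>
proof (induction r rule: dec_induct)
  case base
  have "card {m \<in> {1..k R}. P m} \<le> card {1..k R}"
    by (intro card_mono) auto
  then show ?case by simp
next
  case (step r)
  \<comment> \<open>Subtraction in \<open>lac_step\<close> is truncated; this makes it a true
    difference, so that the block bounds telescope.\<close>
  have le: "k r \<le> k (Suc r)"
    using \<open>strict_mono k\<close> by (simp add: strict_mono_less_eq)
  have "{m \<in> {1..k (Suc r)}. P m} \<subseteq> {m \<in> {1..k r}. P m} \<union> {m \<in> lac_block k (Suc r). P m}"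
    by (auto simp: lac_block_def)
  then have "card {m \<in> {1..k (Suc r)}. P m}
      \<le> card ({m \<in> {1..k r}. P m} \<union> {m \<in> lac_block k (Suc r). P m})"
    by (intro card_mono) (auto simp: lac_block_def)
  also have "\<dots> \<le> card {m \<in> {1..k r}. P m} + card {m \<in> lac_block k (Suc r). P m}"
    by (rule card_Un_le)
  finally have "real (card {m \<in> {1..k (Suc r)}. P m})
      \<le> real (card {m \<in> {1..k r}. P m}) + real (card {m \<in> lac_block k (Suc r). P m})"
    by linarith
  moreover have "real (card {m \<in> lac_block k (Suc r). P m}) \<le> e * (real (k (Suc r)) - real (k r))"
    using block[of "Suc r"] step.hyps le by (simp add: lac_step_def of_nat_diff)
  ultimately show ?case
    using step.IH by (simp add: algebra_simps)
qed

text \<open>Only counts of exceptional integers matter here, so \<open>P\<close> is arbitrary.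
  Bounded ratios ensure that rounding t up to the end of its block costs at most a constant
  factor.\<close>

lemma density_zero_if_lac_density_zero:
  fixes k :: "nat \<Rightarrow> nat"
  assumes mono: "strict_mono k"
    and ratio: "limsup (\<lambda>r. ereal (lac_ratio k r)) < \<infinity>"
    and lac: "(\<lambda>r. real (card {m \<in> lac_block k r. P m}) / real (lac_step k r)) \<longlonglongrightarrow> 0"
  shows "(\<lambda>t. real (card {m \<in> {1..t}. P m}) / real t) \<longlonglongrightarrow> 0"
proof (rule LIMSEQ_I)
  fix \<epsilon> :: real assume "\<epsilon> > 0"
  obtain M0 where "limsup (\<lambda>r. ereal (lac_ratio k r)) < ereal M0"
    using ereal_dense2[OF ratio] by blast
  then have "\<forall>\<^sub>F r in sequentially. lac_ratio k r < M0"
    using Limsup_lessD by fastforce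
  then obtain R1 where R1: "\<And>r. r \<ge> R1 \<Longrightarrow> lac_ratio k r < M0"
    by (auto simp: eventually_sequentially)
  \<comment> \<open>The maximum with 0 makes \<open>M + 1 > 0\<close> immediate. In
    \<open>e * (M + 1)\<close>, the summand 1 pays for the integers up to \<open>k R\<close> and
    \<open>M\<close> for the later blocks.\<close>
  define M where "M = max M0 0"
  define e where "e = \<epsilon> / (2 * (M + 1))"
  have "M \<ge> 0" by (simp add: M_def)
  then have "e > 0" and eM: "e * (M + 1) = \<epsilon> / 2"
    using \<open>\<epsilon> > 0\<close> by (simp_all add: e_def field_simps)
  obtain R2 where R2: "\<And>r. r \<ge> R2 \<Longrightarrow>
      real (card {m \<in> lac_block k r. P m}) / real (lac_step k r) < e"
    using LIMSEQ_D[OF lac \<open>e > 0\<close>] by auto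
  \<comment> \<open>\<open>Suc\<close> gives \<open>R > 0\<close>, hence
    \<open>k (r - 1) > 0\<close> for all \<open>r > R\<close>, even if
    \<open>k 0 = 0\<close>.\<close>
  define R where "R = Suc (max R1 R2)"
  then have "R > 0" "R1 \<le> R" "R2 \<le> R" by simp_all
  have block: "real (card {m \<in> lac_block k r. P m}) \<le> e * real (lac_step k r)" if "r > R" for r
  proof -
    have "k (r - 1) < k r"
      using mono that by (simp add: strict_mono_less)
    then have "lac_step k r > 0" by (simp add: lac_step_def)
    then show ?thesis
      using R2[of r] \<open>R2 \<le> R\<close> that by (simp add: divide_less_eq)
  qed
  obtain T where T: "real (k R) / e < real T"
    using reals_Archimedean2 by blast
  \<comment> \<open>\<open>T\<close> makes \<open>k R\<close> small against \<open>e * t\<close>;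
    \<open>t > k R\<close> puts t in a block beyond \<open>R\<close>.\<close>
  have "norm (real (card {m \<in> {1..t}. P m}) / real t - 0) < \<epsilon>" if "t \<ge> max T (Suc (k R))" for t
  proof -
    have t: "t \<ge> T" "t > k R" using that by auto
    \<comment> \<open>This is the index of the block containing t; it exists because
      \<open>t \<le> k t\<close>.\<close>
    define r where "r = (LEAST r. t \<le> k r)"
    have "t \<le> k t"
      using mono by (rule strict_mono_imp_increasing)
    then have up: "t \<le> k r"
      unfolding r_def by (rule LeastI)
    have "R < r"
      using up t strict_mono_less[OF mono, of R r] by simp
    then have lo: "k (r - 1) < t"
      using not_less_Least[of "r - 1" "\<lambda>r. t \<le> k r"] by (simp add: r_def[symmetric])
    \<comment> \<open>With a zero denominator \<open>lac_ratio\<close> would be 0 by convention and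
      would not bound \<open>k r\<close>.\<close>
    have "0 < k (r - 1)"
      using strict_mono_imp_increasing[OF mono, of "r - 1"] \<open>R < r\<close> \<open>R > 0\<close> by simp
    then have "real (k r) \<le> M0 * real (k (r - 1))"
      using R1[of r] \<open>R < r\<close> \<open>R1 \<le> R\<close> by (simp add: lac_ratio_def field_simps)
    also have "\<dots> \<le> M * real (k (r - 1))"
      by (simp add: M_def mult_right_mono)
    also have "\<dots> \<le> M * real t"
      using lo \<open>M \<ge> 0\<close> by (simp add: mult_left_mono)
    finally have kr: "real (k r) \<le> M * real t" .
    have "real (k R) < e * real T"
      using T \<open>e > 0\<close> by (simp add: field_simps)
    also have "\<dots> \<le> e * real t"
      using t \<open>e > 0\<close> by simp
    finally have kR: "real (k R) < e * real t" .
    have "card {m \<in> {1..t}. P m} \<le> card {m \<in> {1..k r}. P m}"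
      using up by (intro card_mono) auto
    also have "real \<dots> \<le> real (k R) + e * (real (k r) - real (k R))"
      using card_initial_le_lac_blocks[where P = P, OF mono block] \<open>r > R\<close> by simp
    also have "\<dots> \<le> real (k R) + e * real (k r)"
      using \<open>e > 0\<close> by simp
    also have "\<dots> \<le> e * real t + e * (M * real t)"
      using kR kr \<open>e > 0\<close> by (intro add_mono mult_left_mono) auto
    also have "\<dots> = e * (M + 1) * real t"
      by (simp add: algebra_simps)
    also have "\<dots> < \<epsilon> * real t"
      unfolding eM using \<open>\<epsilon> > 0\<close> t by simp
    finally have "real (card {m \<in> {1..t}. P m}) < \<epsilon> * real t" by simp
    then show ?thesis
      using t by (simp add: field_simps)
  qed
  then show "\<exists>T. \<forall>t\<ge>T. norm (real (card {m \<in> {1..t}. P m}) / real t - 0) < \<epsilon>"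
    by blast
qed

theorem theorem2p7:
  fixes k :: "nat \<Rightarrow> nat"
  assumes "lacunary k"
    and "limsup (\<lambda>r. ereal (lac_ratio k r)) < \<infinity>"
  shows "ASC_lac k \<subseteq> ASC"
proof (rule subsetI, unfold ASC_def, intro CollectI allI impI)
  fix x and \<epsilon> :: real assume "x \<in> ASC_lac k" "\<epsilon> > 0"
  then obtain n where "n > 0"
    and lac: "(\<lambda>r. real (card {m \<in> lac_block k r. \<bar>x m - x (gcd m n)\<bar> \<ge> \<epsilon>}) / real (lac_step k r))
      \<longlonglongrightarrow> 0"
    unfolding ASC_lac_def by auto
  have "strict_mono k"
    using assms(1) by (simp add: lacunary_def)
  \<comment> \<open>The same n serves for both densities: once \<epsilon> and n are fixed, the
    exceptional condition is a single predicate of m.\<close>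
  from density_zero_if_lac_density_zero[OF this assms(2) lac] \<open>n > 0\<close>
  show "\<exists>n>0. (\<lambda>t. real (card {m \<in> {1..t}. \<bar>x m - x (gcd m n)\<bar> \<ge> \<epsilon>}) / real t) \<longlonglongrightarrow> 0"
    by (intro exI[of _ n] conjI)
qed

end
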